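(* Let $t$ be a positive integer and let $G$ be a bridgeless cubic graph with $|E(G)|<\frac{2^t}{\sqrt{t}}$. Then there exist $t$ perfect matchings $M_1,\ldots,M_t$ of $G$ such that $\bigcup_{i=1}^t M_i=E(G)$.
   Context: All graphs are finite, simple (no loops, no parallel edges) and connected. A graph is cubic if every vertex has degree 3, and bridgeless if the removal of any single edge leaves it connected. $E(G)$ is the edge-set of $G$. A perfect matching of $G$ is a $1$-regular spanning subgraph of $G$, identified with its set of edges. The perfect matchings $M_1,\ldots,M_t$ are not required to be distinct. *)

theory Defs
  imports Complex_Main
begin

text \<open>
  A graph is given by its vertex set and its set of edges, an edge being the two-element set of its
  endpoints; this excludes loops and parallel edges.
\<close>

definition finite_simple_graph :: "'a set \<Rightarrow> 'a set set \<Rightarrow> bool" where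
  "finite_simple_graph V E \<longleftrightarrow> finite V \<and> (\<forall>e\<in>E. e \<subseteq> V \<and> card e = 2)"

definition graph_connected :: "'a set \<Rightarrow> 'a set set \<Rightarrow> bool" where
  "graph_connected V E \<longleftrightarrow>
     V \<noteq> {} \<and> (\<forall>u\<in>V. \<forall>v\<in>V. (u, v) \<in> {(x, y). {x, y} \<in> E}\<^sup>*)"

definition degree :: "'a set set \<Rightarrow> 'a \<Rightarrow> nat" where
  "degree E v = card {e \<in> E. v \<in> e}"

definition regular :: "nat \<Rightarrow> 'a set \<Rightarrow> 'a set set \<Rightarrow> bool" where
  "regular k V E \<longleftrightarrow> (\<forall>v\<in>V. degree E v = k)"

definition cubic :: "'a set \<Rightarrow> 'a set set \<Rightarrow> bool" where
  "cubic V E \<longleftrightarrow> regular 3 V E"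

definition bridgeless :: "'a set \<Rightarrow> 'a set set \<Rightarrow> bool" where
  "bridgeless V E \<longleftrightarrow> (\<forall>e\<in>E. graph_connected V (E - {e}))"

text \<open>A spanning subgraph keeps all of \<open>V\<close>, so it is determined by its edge set \<open>M\<close>.\<close>

definition perfect_matching :: "'a set \<Rightarrow> 'a set set \<Rightarrow> 'a set set \<Rightarrow> bool" where
  "perfect_matching V E M \<longleftrightarrow> M \<subseteq> E \<and> regular 1 V M"

end

theory Submission
  imports Defs
begin

text \<open>
  The proof builds the matchings one after another and chooses each by averaging over a fractional
  perfect matching; this is the method of Kaiser, Kral and Norine.

  Suppose that \<open>k\<close> perfect matchings have been chosen and that the edge \<open>e\<close> lies in \<open>n e\<close> of them.
  Give \<open>e\<close> the weight \<open>w e = (k + 1 - n e) / (2 * k + 3)\<close>. In a cubic graph these weights sum to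
  \<open>1\<close> at every vertex. If they also sum to at least \<open>1\<close> across every odd cut, then by Edmonds'
  theorem on the perfect matching polytope \<open>w\<close> is an average of perfect matchings, so that some
  perfect matching \<open>M\<close> contains at least as many uncovered edges as \<open>w\<close> does, namely the
  proportion \<open>(k + 1) / (2 * k + 3)\<close> of them. Hence \<open>t\<close> matchings can be chosen that leave at most
  the proportion \<open>(\<Prod>i=1..t. (i + 1) / (2 * i + 1))\<close> of the edges uncovered. This product is
  asymptotically \<open>sqrt (pi * t) / 2\<close> divided by \<open>2 ^ t\<close>, and under the bound on the number of edges
  less than one edge remains.

  The odd cut condition must survive the step (\<open>extend_cut_balanced\<close>). All matchings in the average
  meet every odd cut of weight exactly \<open>1\<close> in one edge, so \<open>M\<close> can be chosen with this property too
  (\<open>matching_meeting_tight_cuts_once\<close>). On such a cut the condition survives because in a bridgeless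
  cubic graph an odd cut has at least three edges; on every other odd cut parity leaves enough slack.

  Edmonds' theorem is proved for multigraphs (\<open>matching_polytope\<close>), in the form needed here: some
  perfect matching does at least as well as \<open>w\<close> for a given linear objective. The induction is on the
  number of vertices and edges. An edge of weight \<open>0\<close> is deleted, and an edge of weight \<open>1\<close> is put
  into the matching and removed with both ends. Otherwise \<open>w\<close> can be moved along a direction that
  keeps all vertex sums and does not decrease the objective, until an edge gets weight \<open>0\<close> or an odd
  cut becomes tight. Across a tight cut, each of the two sides is contracted and the matchings of the
  two smaller graphs are glued along a common cut edge (\<open>glue_across_tight_cut\<close>).
\<close>

section \<open>Multigraphs, cuts and fractional perfect matchings\<close>

text \<open>
  Contraction creates parallel edges, so edges are abstract and carry their set of endpoints.
  This set has two elements: loops are excluded.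
\<close>

definition multigraph :: "'v set \<Rightarrow> 'e set \<Rightarrow> ('e \<Rightarrow> 'v set) \<Rightarrow> bool" where
  "multigraph V E ends \<longleftrightarrow>
     finite V \<and> finite E \<and> (\<forall>e\<in>E. ends e \<subseteq> V \<and> card (ends e) = 2)"

text \<open>
  The edges with exactly one endpoint in \<open>S\<close>. The form chosen here does not mention
  cardinalities, which makes it stable under taking images of the endpoint sets. As there are no
  loops, the cut of \<open>{v}\<close> consists of the edges at \<open>v\<close>.
\<close>

definition cut :: "'e set \<Rightarrow> ('e \<Rightarrow> 'v set) \<Rightarrow> 'v set \<Rightarrow> 'e set" where
  "cut E ends S = {e \<in> E. ends e \<inter> S \<noteq> {} \<and> \<not> ends e \<subseteq> S}"

text \<open>
  Membership in the perfect matching polytope, described by Edmonds' inequalities. A set \<open>V\<close> of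
  odd size is excluded by the last condition, because the cut of \<open>V\<close> is empty.
\<close>

definition fractional_matching ::
  "'v set \<Rightarrow> 'e set \<Rightarrow> ('e \<Rightarrow> 'v set) \<Rightarrow> ('e \<Rightarrow> real) \<Rightarrow> bool" where
  "fractional_matching V E ends w \<longleftrightarrow>
     (\<forall>e\<in>E. 0 \<le> w e) \<and> (\<forall>v\<in>V. sum w (cut E ends {v}) = 1) \<and>
     (\<forall>S\<subseteq>V. odd (card S) \<longrightarrow> 1 \<le> sum w (cut E ends S))"

definition matching :: "'v set \<Rightarrow> 'e set \<Rightarrow> ('e \<Rightarrow> 'v set) \<Rightarrow> 'e set \<Rightarrow> bool" where
  "matching V E ends M \<longleftrightarrow> M \<subseteq> E \<and> (\<forall>v\<in>V. card (cut M ends {v}) = 1)"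

lemma finite_cut [simp]: "finite E \<Longrightarrow> finite (cut E ends S)"
  by (simp add: cut_def)

lemma cut_subset: "cut E ends S \<subseteq> E"
  by (auto simp: cut_def)

lemma cut_inter: "M \<subseteq> E \<Longrightarrow> cut M ends S = M \<inter> cut E ends S"
  by (auto simp: cut_def)

lemma edge_ends:
  assumes "multigraph V E ends" "e \<in> E"
  obtains x y where "ends e = {x, y}" "x \<noteq> y" "x \<in> V" "y \<in> V"
  using assms unfolding multigraph_def by (metis card_2_iff insert_subset)

lemma cut_single:
  assumes "multigraph V E ends" "F \<subseteq> E"
  shows "cut F ends {v} = {e \<in> F. v \<in> ends e}"
proof -
  have "\<not> ends e \<subseteq> {v}" if "e \<in> F" for e
    using edge_ends[OF assms(1), of e] that assms(2)
    by (metis insert_subset singletonD subsetD)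
  then show ?thesis by (auto simp: cut_def)
qed

lemma cut_complement:
  assumes "multigraph V E ends"
  shows "cut E ends (V - S) = cut E ends S"
  using assms by (auto simp: cut_def multigraph_def)

text \<open>
  Double counting: an edge is counted once for each of its endpoints in \<open>S\<close>. All parity arguments
  below come from this identity.
\<close>

lemma sum_stars:
  fixes f :: "'e \<Rightarrow> 'b::comm_semiring_1"
  assumes g: "multigraph V E ends" and F: "F \<subseteq> E" and S: "S \<subseteq> V"
  shows "(\<Sum>v\<in>S. sum f (cut F ends {v})) =
     2 * sum f {e \<in> F. ends e \<subseteq> S} + sum f (cut F ends S)"
proof -
  have fin: "finite F" "finite S"
    using g F S by (auto simp: multigraph_def intro: finite_subset)
  \<comment> \<open>An edge has two endpoints in \<open>S\<close> if it lies inside \<open>S\<close>, and one if it crosses the cut.\<close>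
  have c: "f e * of_nat (card (ends e \<inter> S)) =
      2 * (if ends e \<subseteq> S then f e else 0) + (if e \<in> cut F ends S then f e else 0)"
    if "e \<in> F" for e
  proof -
    have "e \<in> E" using F that by blast
    then obtain x y where xy: "ends e = {x, y}" "x \<noteq> y"
      using edge_ends[OF g] by metis
    show ?thesis
      using xy that by (cases "x \<in> S"; cases "y \<in> S") (auto simp: cut_def mult.commute)
  qed
  have "(\<Sum>v\<in>S. sum f (cut F ends {v})) = (\<Sum>v\<in>S. \<Sum>e\<in>F. if v \<in> ends e then f e else 0)"
    using fin(1) by (simp add: cut_single[OF g F] sum.inter_filter)
  also have "\<dots> = (\<Sum>e\<in>F. \<Sum>v\<in>S. if v \<in> ends e then f e else 0)"
    by (rule sum.swap)
  also have "\<dots> = (\<Sum>e\<in>F. f e * of_nat (card (ends e \<inter> S)))"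
    using fin by (simp add: sum.If_cases Int_commute mult.commute)
  also have "\<dots> = (\<Sum>e\<in>F. 2 * (if ends e \<subseteq> S then f e else 0) + (if e \<in> cut F ends S then f e else 0))"
    by (rule sum.cong[OF refl c])
  also have "\<dots> = 2 * sum f {e \<in> F. ends e \<subseteq> S} + sum f (cut F ends S)"
  proof -
    have "{e \<in> F. e \<in> cut F ends S} = cut F ends S" by (auto simp: cut_def)
    then show ?thesis
      using fin(1) by (simp add: sum.distrib sum_distrib_left[symmetric] sum.inter_filter[symmetric])
  qed
  finally show ?thesis .
qed

lemma matching_parity:
  assumes g: "multigraph V E ends" and M: "matching V E ends M" and S: "S \<subseteq> V"
  shows "odd (card (cut M ends S)) \<longleftrightarrow> odd (card S)"
proof -
  have "(\<Sum>v\<in>S. \<Sum>e\<in>cut M ends {v}. 1::nat) = 2 * (\<Sum>e\<in>{e \<in> M. ends e \<subseteq> S}. 1) + (\<Sum>e\<in>cut M ends S. 1)"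
    using M by (intro sum_stars[OF g _ S]) (simp add: matching_def)
  moreover have "(\<Sum>v\<in>S. \<Sum>e\<in>cut M ends {v}. 1::nat) = card S"
    using M S by (simp add: matching_def subset_iff)
  ultimately have "card S = 2 * card {e \<in> M. ends e \<subseteq> S} + card (cut M ends S)"
    by simp
  then show ?thesis by simp
qed

section \<open>Contraction\<close>

text \<open>
  Contracting \<open>U\<close> keeps the edges and redirects their endpoints in \<open>U\<close> to a representative \<open>u\<close> of
  \<open>U\<close>; edges inside \<open>U\<close> would become loops and are dropped wherever \<open>shrink\<close> is used.
\<close>

definition shrink :: "'v set \<Rightarrow> 'v \<Rightarrow> ('e \<Rightarrow> 'v set) \<Rightarrow> 'e \<Rightarrow> 'v set" where
  "shrink U u ends e = (\<lambda>x. if x \<in> U then u else x) ` ends e"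

text \<open>
  The cuts of the contracted graph are exactly the cuts of the original graph that do not separate
  \<open>U\<close>. Therefore contraction preserves all conditions on a fractional matching.
\<close>

lemma cut_shrink:
  assumes "F \<subseteq> E"
    and "u \<in> U" "S \<inter> U \<subseteq> {u}"
  shows "cut {e \<in> F. \<not> ends e \<subseteq> U} (shrink U u ends) S =
     cut F ends (if u \<in> S then S \<union> U else S)"
proof -
  have *: "shrink U u ends e \<inter> S \<noteq> {} \<longleftrightarrow> ends e \<inter> (if u \<in> S then S \<union> U else S) \<noteq> {}"
     "shrink U u ends e \<subseteq> S \<longleftrightarrow> ends e \<subseteq> (if u \<in> S then S \<union> U else S)" for e
    using assms(2,3) by (auto simp: shrink_def split: if_splits)
  have "\<not> (ends e \<subseteq> U \<and> e \<in> cut F ends (if u \<in> S then S \<union> U else S))" for e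
    using assms(2,3) by (auto simp: cut_def)
  then show ?thesis unfolding cut_def * by blast
qed

text \<open>
  The vertex sum at the new vertex is the weight of the cut of \<open>U\<close>, which explains why the cut has
  to be tight. As \<open>U\<close> is odd, replacing \<open>u\<close> by \<open>U\<close> does not change the parity of a vertex set.
\<close>

lemma contraction:
  assumes g: "multigraph V E ends" and w: "fractional_matching V E ends w"
    and U: "U \<subseteq> V" "u \<in> U" "odd (card U)" and tight: "sum w (cut E ends U) = 1"
  defines "V' \<equiv> insert u (V - U)" and "E' \<equiv> {e \<in> E. \<not> ends e \<subseteq> U}"
  shows "multigraph V' E' (shrink U u ends)"
    and "fractional_matching V' E' (shrink U u ends) w"
proof -
  have finV: "finite V" "finite E" using g by (auto simp: multigraph_def)
  have "shrink U u ends e \<subseteq> V' \<and> card (shrink U u ends e) = 2" if "e \<in> E'" for e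
  proof -
    have eE: "e \<in> E" using that by (simp add: E'_def)
    obtain x y where xy: "ends e = {x, y}" "x \<noteq> y" "x \<in> V" "y \<in> V"
      using edge_ends[OF g eE] .
    then show ?thesis
      using that U(2) by (cases "x \<in> U"; cases "y \<in> U") (auto simp: shrink_def E'_def V'_def card_insert_if)
  qed
  then show "multigraph V' E' (shrink U u ends)"
    using finV by (simp add: multigraph_def V'_def E'_def)
  have star: "sum w (cut E' (shrink U u ends) {v}) = 1" if "v \<in> V'" for v
    using that w tight U cut_shrink[OF order_refl, of u U "{v}" E ends]
    unfolding E'_def V'_def fractional_matching_def
    by (cases "v = u") (auto simp: insert_absorb)
  have "1 \<le> sum w (cut E' (shrink U u ends) S)" if S: "S \<subseteq> V'" "odd (card S)" for S
  proof -
    let ?S = "if u \<in> S then S \<union> U else S"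
    have SU: "S \<inter> U \<subseteq> {u}" using S unfolding V'_def by blast
    have "odd (card ?S)"
    proof (cases "u \<in> S")
      case True
      have fin: "finite S" "finite U"
        using S U finV by (auto simp: V'_def intro: finite_subset)
      have "S \<inter> U = {u}" using True U SU by blast
      then have "card S + card U = card (S \<union> U) + 1"
        using card_Un_Int[OF fin] by simp
      then show ?thesis using True S U by (metis even_add odd_one)
    qed (use S in simp)
    moreover have "?S \<subseteq> V" using S U by (auto simp: V'_def)
    ultimately have "1 \<le> sum w (cut E ends ?S)"
      using w by (simp add: fractional_matching_def)
    then show ?thesis
      using cut_shrink[OF order_refl U(2) SU, of E ends] by (simp add: E'_def)
  qed
  then show "fractional_matching V' E' (shrink U u ends) w"
    using w star by (auto simp: fractional_matching_def E'_def)
qed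

lemma matching_contraction:
  assumes U: "U \<subseteq> V" "u \<in> U"
    and M: "matching (insert u (V - U)) {e \<in> E. \<not> ends e \<subseteq> U} (shrink U u ends) M"
  shows "M \<subseteq> {e \<in> E. \<not> ends e \<subseteq> U}" "card (cut M ends U) = 1"
    "\<And>v. v \<in> V - U \<Longrightarrow> card (cut M ends {v}) = 1"
proof -
  show sub: "M \<subseteq> {e \<in> E. \<not> ends e \<subseteq> U}"
    using M by (simp add: matching_def)
  have M': "{e \<in> M. \<not> ends e \<subseteq> U} = M" using sub by blast
  have deg: "card (cut M (shrink U u ends) {v}) = 1" if "v \<in> insert u (V - U)" for v
    using M that unfolding matching_def by blast
  show "card (cut M ends U) = 1"
    using deg[of u] cut_shrink[OF order_refl U(2), of "{u}" M ends] U M'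
    by (simp add: insert_absorb)
  show "card (cut M ends {v}) = 1" if "v \<in> V - U" for v
    using deg[of v] cut_shrink[OF order_refl U(2), of "{v}" M ends] U M' that
    by (auto split: if_splits)
qed

text \<open>
  With \<open>A\<close> and \<open>B\<close> nonempty the maxima serve as bounds. The lemma exists for the case in which one
  of them is empty: then its bound can be made as small as necessary.
\<close>

lemma separating_bounds:
  fixes A B :: "real set"
  assumes "finite A" "finite B" and less: "\<And>x y. x \<in> A \<Longrightarrow> y \<in> B \<Longrightarrow> x + y < k"
  shows "\<exists>a b. (\<forall>x\<in>A. x \<le> a) \<and> (\<forall>y\<in>B. y \<le> b) \<and> a + b < k"
proof (cases "A = {} \<or> B = {}")
  case True
  then consider "A = {}" | "B = {}" by blast
  then show ?thesis
  proof cases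
    case 1
    then show ?thesis
      using assms(2) by (intro exI[of _ "k - 1 - Max B"] exI[of _ "Max B"]) auto
  next
    case 2
    then show ?thesis
      using assms(1) by (intro exI[of _ "Max A"] exI[of _ "k - 1 - Max A"]) auto
  qed
next
  case False
  then show ?thesis
    using assms by (intro exI[of _ "Max A"] exI[of _ "Max B"]) (auto intro!: less)
qed

text \<open>
  Suppose that all perfect matchings are worse than \<open>w\<close>. Then every cut edge \<open>f\<close> admits upper bounds
  \<open>a f\<close> and \<open>b f\<close> for the value that a matching containing \<open>f\<close> attains inside either side, such that
  \<open>a f + b f + c f\<close> is less than the value \<open>W\<close> of \<open>w\<close>; otherwise two matchings that share \<open>f\<close> could be
  glued to a matching of value at least \<open>W\<close>. On one contracted graph, take the objective that is \<open>- a f\<close>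
  on cut edges and \<open>c\<close> elsewhere. No matching has positive value, so by optimality neither has \<open>w\<close>;
  likewise for \<open>b\<close> on the other side. Adding up shows that \<open>W\<close> is at most the average of
  \<open>a f + b f + c f\<close> under the weights \<open>w f\<close>, which sum to \<open>1\<close> over the cut. This is impossible.
\<close>

lemma glue_across_tight_cut:
  fixes c w :: "'e \<Rightarrow> real"
  assumes g: "multigraph V E ends" and w: "fractional_matching V E ends w"
    and U: "U \<subseteq> V" "odd (card U)" "odd (card (V - U))"
    and tight: "sum w (cut E ends U) = 1" and u: "u \<in> U" and z: "z \<in> V - U"
    and opt1: "\<And>c :: 'e \<Rightarrow> real. \<exists>M. matching (insert u (V - U)) {e \<in> E. \<not> ends e \<subseteq> U} (shrink U u ends) M \<and>
        (\<Sum>e\<in>{e \<in> E. \<not> ends e \<subseteq> U}. c e * w e) \<le> sum c M"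
    and opt2: "\<And>c :: 'e \<Rightarrow> real. \<exists>M. matching (insert z U) {e \<in> E. \<not> ends e \<subseteq> V - U} (shrink (V - U) z ends) M \<and>
        (\<Sum>e\<in>{e \<in> E. \<not> ends e \<subseteq> V - U}. c e * w e) \<le> sum c M"
  shows "\<exists>M. matching V E ends M \<and> (\<Sum>e\<in>E. c e * w e) \<le> sum c M"
proof (rule ccontr)
  assume none: "\<not> ?thesis"
  define C where "C = cut E ends U"
  define E1 where "E1 = {e \<in> E. \<not> ends e \<subseteq> U}"
  define E2 where "E2 = {e \<in> E. \<not> ends e \<subseteq> V - U}"
  define P1 where "P1 = {M. matching (insert u (V - U)) E1 (shrink U u ends) M}"
  define P2 where "P2 = {M. matching (insert z U) E2 (shrink (V - U) z ends) M}"
  define W where "W = (\<Sum>e\<in>E. c e * w e)"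
  have fin: "finite E" "finite V" using g by (auto simp: multigraph_def)
  have endsV: "ends e \<subseteq> V" "ends e \<noteq> {}" if "e \<in> E" for e
    using g that by (auto simp: multigraph_def)
  have "\<not> (ends e \<subseteq> U \<and> ends e \<subseteq> V - U)" if "e \<in> E" for e
    using endsV[OF that] by blast
  then have C12: "C = E1 \<inter> E2" "E = E1 \<union> E2"
    using endsV by (auto simp: C_def E1_def E2_def cut_def)
  have VU: "V - (V - U) = U" using U by blast
  have p1: "M \<subseteq> E1" "card (M \<inter> C) = 1" "\<And>v. v \<in> V - U \<Longrightarrow> card (cut M ends {v}) = 1"
    if "M \<in> P1" for M
  proof -
    note m = matching_contraction[OF U(1) u, of E ends M, folded E1_def]
    have m': "matching (insert u (V - U)) E1 (shrink U u ends) M" using that by (simp add: P1_def)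
    show s: "M \<subseteq> E1" using m(1)[OF m'] .
    then have "M \<subseteq> E" using C12(2) by blast
    then show "card (M \<inter> C) = 1"
      using m(2)[OF m'] cut_inter[of M E ends U] by (simp add: C_def)
    show "\<And>v. v \<in> V - U \<Longrightarrow> card (cut M ends {v}) = 1" using m(3)[OF m'] .
  qed
  have p2: "M \<subseteq> E2" "card (M \<inter> C) = 1" "\<And>v. v \<in> U \<Longrightarrow> card (cut M ends {v}) = 1"
    if "M \<in> P2" for M
  proof -
    note m = matching_contraction[OF Diff_subset z, of E ends M, folded E2_def, unfolded VU]
    have m': "matching (insert z U) E2 (shrink (V - U) z ends) M" using that by (simp add: P2_def)
    show s: "M \<subseteq> E2" using m(1)[OF m'] .
    then have "M \<subseteq> E" using C12(2) by blast
    then show "card (M \<inter> C) = 1"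
      using m(2)[OF m'] cut_inter[of M E ends "V - U"] cut_complement[OF g, of U]
      by (simp add: C_def)
    show "\<And>v. v \<in> U \<Longrightarrow> card (cut M ends {v}) = 1" using m(3)[OF m'] .
  qed
  have finP: "finite P1" "finite P2"
    using p1(1) p2(1) fin C12
    by (auto intro!: finite_subset[of P1 "Pow E1"] finite_subset[of P2 "Pow E2"])
  have finM: "finite M" if "M \<in> P1 \<union> P2" for M
  proof -
    have "M \<subseteq> E" using that p1(1) p2(1) C12(2) by blast
    then show ?thesis using fin(1) by (rule finite_subset)
  qed
  have glued: "sum c (M1 - C) + sum c (M2 - C) + c f < W"
    if M: "M1 \<in> P1" "M2 \<in> P2" and f: "f \<in> M1" "f \<in> M2" "f \<in> C" for M1 M2 f
  proof -
    have C1: "M1 \<inter> C = {f}" and C2: "M2 \<inter> C = {f}"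
      using p1(2)[OF M(1)] p2(2)[OF M(2)] f by (metis IntI card_1_singletonE singletonD)+
    have s: "M1 \<subseteq> E1" "M2 \<subseteq> E2" using p1(1) p2(1) M by auto
    have "cut (M1 \<union> M2) ends {v} = cut M1 ends {v}" if "v \<in> V - U" for v
    proof -
      have "e \<in> M1" if e: "e \<in> M2" "v \<in> ends e" for e
      proof -
        have "e \<in> E2" using e(1) s by blast
        then have "e \<in> E1" using e(2) \<open>v \<in> V - U\<close> by (auto simp: E1_def E2_def)
        then have "e \<in> C" using \<open>e \<in> E2\<close> C12(1) by blast
        then show ?thesis using C1 C2 e by blast
      qed
      then show ?thesis by (auto simp: cut_def)
    qed
    moreover have "cut (M1 \<union> M2) ends {v} = cut M2 ends {v}" if "v \<in> U" for v
    proof -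
      have "e \<in> M2" if e: "e \<in> M1" "v \<in> ends e" for e
      proof -
        have "e \<in> E1" using e(1) s by blast
        then have "e \<in> E2" using e(2) \<open>v \<in> U\<close> by (auto simp: E1_def E2_def)
        then have "e \<in> C" using \<open>e \<in> E1\<close> C12(1) by blast
        then show ?thesis using C1 C2 e by blast
      qed
      then show ?thesis by (auto simp: cut_def)
    qed
    ultimately have "matching V E ends (M1 \<union> M2)"
      using s C12(2) p1(3)[OF M(1)] p2(3)[OF M(2)] unfolding matching_def
      by (metis DiffI Un_mono)
    then have "sum c (M1 \<union> M2) < W" using none by (auto simp: W_def not_le)
    moreover have "M1 \<union> M2 = insert f ((M1 - C) \<union> (M2 - C))" using C1 C2 by blast
    moreover have "(M1 - C) \<inter> (M2 - C) = {}" using s C12 by blast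
    ultimately show ?thesis
      using finM M f by (simp add: sum.union_disjoint)
  qed
  have "\<exists>a b. (\<forall>M\<in>P1. f \<in> M \<longrightarrow> sum c (M - C) \<le> a) \<and> (\<forall>M\<in>P2. f \<in> M \<longrightarrow> sum c (M - C) \<le> b) \<and>
      a + b < W - c f" if "f \<in> C" for f
  proof -
    have "\<exists>a b. (\<forall>x\<in>(\<lambda>M. sum c (M - C)) ` {M \<in> P1. f \<in> M}. x \<le> a) \<and>
        (\<forall>x\<in>(\<lambda>M. sum c (M - C)) ` {M \<in> P2. f \<in> M}. x \<le> b) \<and> a + b < W - c f"
      using finP that by (intro separating_bounds) (auto dest: glued[rotated -1])
    then show ?thesis by (auto simp: ball_simps)
  qed
  then obtain a b where ab:
    "\<And>f M. f \<in> C \<Longrightarrow> M \<in> P1 \<Longrightarrow> f \<in> M \<Longrightarrow> sum c (M - C) \<le> a f"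
    "\<And>f M. f \<in> C \<Longrightarrow> M \<in> P2 \<Longrightarrow> f \<in> M \<Longrightarrow> sum c (M - C) \<le> b f"
    "\<And>f. f \<in> C \<Longrightarrow> a f + b f < W - c f"
    by metis
  \<comment> \<open>The same computation serves both sides, with \<open>h\<close> standing for \<open>a\<close> or \<open>b\<close>.\<close>
  have bound: "(\<Sum>e\<in>F - C. c e * w e) \<le> (\<Sum>e\<in>C. h e * w e)"
    if F: "C \<subseteq> F" "F \<subseteq> E" and M: "M \<subseteq> F" "card (M \<inter> C) = 1"
      and best: "(\<Sum>e\<in>F. (if e \<in> C then - h e else c e) * w e) \<le> (\<Sum>e\<in>M. if e \<in> C then - h e else c e)"
      and h: "\<And>f. f \<in> C \<Longrightarrow> f \<in> M \<Longrightarrow> sum c (M - C) \<le> h f" for F M h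
  proof -
    have finF: "finite F" "finite M" using F M fin by (auto intro: finite_subset)
    obtain f where f: "M \<inter> C = {f}" using M(2) by (auto simp: card_1_singleton_iff)
    have "(\<Sum>e\<in>F. (if e \<in> C then - h e else c e) * w e) =
        (\<Sum>e\<in>F - C. (if e \<in> C then - h e else c e) * w e) + (\<Sum>e\<in>C. (if e \<in> C then - h e else c e) * w e)"
      using sum.subset_diff[OF F(1) finF(1)] .
    also have "\<dots> = (\<Sum>e\<in>F - C. c e * w e) - (\<Sum>e\<in>C. h e * w e)"
      by (simp add: sum_negf)
    finally have l: "(\<Sum>e\<in>F. (if e \<in> C then - h e else c e) * w e) = (\<Sum>e\<in>F - C. c e * w e) - (\<Sum>e\<in>C. h e * w e)" .
    have "(\<Sum>e\<in>M. if e \<in> C then - h e else c e) = sum (\<lambda>e. - h e) (M \<inter> C) + sum c (M - C)"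
      using finF by (simp add: sum.If_cases Diff_eq Int_def)
    also have "\<dots> \<le> 0" using f h[of f] by auto
    finally show ?thesis using l best by linarith
  qed
  have C_in: "C \<subseteq> E1" "C \<subseteq> E2" "E1 \<subseteq> E" "E2 \<subseteq> E" using C12 by auto
  obtain M1 where M1: "M1 \<in> P1"
    "(\<Sum>e\<in>E1. (if e \<in> C then - a e else c e) * w e) \<le> (\<Sum>e\<in>M1. if e \<in> C then - a e else c e)"
    using opt1[of "\<lambda>e. if e \<in> C then - a e else c e"] by (auto simp: E1_def P1_def)
  have b1: "(\<Sum>e\<in>E1 - C. c e * w e) \<le> (\<Sum>e\<in>C. a e * w e)"
    by (rule bound[OF C_in(1,3) p1(1,2)[OF M1(1)] M1(2)]) (use ab(1) M1(1) in blast)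
  obtain M2 where M2: "M2 \<in> P2"
    "(\<Sum>e\<in>E2. (if e \<in> C then - b e else c e) * w e) \<le> (\<Sum>e\<in>M2. if e \<in> C then - b e else c e)"
    using opt2[of "\<lambda>e. if e \<in> C then - b e else c e"] by (auto simp: E2_def P2_def)
  have b2: "(\<Sum>e\<in>E2 - C. c e * w e) \<le> (\<Sum>e\<in>C. b e * w e)"
    by (rule bound[OF C_in(2,4) p2(1,2)[OF M2(1)] M2(2)]) (use ab(2) M2(1) in blast)
  have finC: "finite C" using fin by (simp add: C_def)
  have "W = (\<Sum>e\<in>(E1 - C) \<union> (E2 - C). c e * w e) + (\<Sum>e\<in>C. c e * w e)"
  proof -
    have "E = ((E1 - C) \<union> (E2 - C)) \<union> C" using C12 by blast
    then show ?thesis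
      using fin finC unfolding W_def by (metis (no_types, lifting) Diff_disjoint Int_commute Un_Diff finite_Un sum.union_disjoint)
  qed
  also have "(\<Sum>e\<in>(E1 - C) \<union> (E2 - C). c e * w e) = (\<Sum>e\<in>E1 - C. c e * w e) + (\<Sum>e\<in>E2 - C. c e * w e)"
    using C12 fin by (intro sum.union_disjoint) auto
  finally have "0 \<le> (\<Sum>e\<in>C. a e * w e) + (\<Sum>e\<in>C. b e * w e) + (\<Sum>e\<in>C. c e * w e) - W * sum w C"
    using b1 b2 tight by (simp add: C_def)
  also have "\<dots> = - (\<Sum>e\<in>C. (W - c e - (a e + b e)) * w e)"
    by (simp add: algebra_simps sum.distrib sum_subtractf sum_distrib_left)
  finally have le: "(\<Sum>e\<in>C. (W - c e - (a e + b e)) * w e) \<le> 0" by simp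
  have w0: "0 \<le> w e" if "e \<in> C" for e
    using w that C_in by (auto simp: fractional_matching_def)
  obtain f where "f \<in> C" "w f > 0"
    using tight w0 sum_nonpos[of C w] unfolding C_def[symmetric] by (metis not_le zero_less_one)
  moreover have "0 \<le> (W - c e - (a e + b e)) * w e" if "e \<in> C" for e
    using ab(3)[OF that] w0[OF that] by simp
  ultimately have "0 < (\<Sum>e\<in>C. (W - c e - (a e + b e)) * w e)"
    using ab(3)[of f] finC by (intro sum_pos2[of C f]) auto
  then show False using le by simp
qed

section \<open>The matching polytope\<close>

lemma handshake:
  fixes f :: "'e \<Rightarrow> 'b::comm_semiring_1"
  assumes g: "multigraph V E ends" and F: "F \<subseteq> E"
  shows "(\<Sum>v\<in>V. sum f (cut F ends {v})) = 2 * sum f F"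
proof -
  have "{e \<in> F. ends e \<subseteq> V} = F" "cut F ends V = {}"
    using g F by (auto simp: multigraph_def cut_def)
  then show ?thesis using sum_stars[OF g F order_refl, of f] by simp
qed

text \<open>
  Gaussian elimination: the equation \<open>r\<close> is solved for one unknown \<open>e0\<close> and substituted into the
  others; \<open>b\<close> is the resulting system.
\<close>

lemma underdetermined_system:
  fixes a :: "'r \<Rightarrow> 'e \<Rightarrow> real"
  assumes "finite R" "finite E" "card R < card E"
  shows "\<exists>d. (\<exists>e\<in>E. d e \<noteq> 0) \<and> (\<forall>r\<in>R. (\<Sum>e\<in>E. a r e * d e) = 0)"
  using assms
proof (induction R arbitrary: E a rule: finite_induct)
  case empty
  then have "E \<noteq> {}" by auto
  then show ?case by (intro exI[of _ "\<lambda>_. 1"]) auto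
next
  case (insert r R)
  show ?case
  proof (cases "\<forall>e\<in>E. a r e = 0")
    case True
    have "card R < card E" using insert by simp
    from insert.IH[OF insert.prems(1) this, of a] True show ?thesis by auto
  next
    case False
    then obtain e0 where e0: "e0 \<in> E" "a r e0 \<noteq> 0" by blast
    define b where "b s e = a s e - a s e0 * a r e / a r e0" for s e
    have "card R < card (E - {e0})" using insert e0 by simp
    from insert.IH[OF _ this, of b] insert.prems(1) obtain d where
      d: "\<exists>e\<in>E - {e0}. d e \<noteq> 0" "\<forall>s\<in>R. (\<Sum>e\<in>E - {e0}. b s e * d e) = 0" by auto
    define x where "x = - (\<Sum>e\<in>E - {e0}. a r e * d e) / a r e0"
    have total: "(\<Sum>e\<in>E. a s e * (d(e0 := x)) e) = (\<Sum>e\<in>E - {e0}. b s e * d e)" for s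
    proof -
      have "(\<Sum>e\<in>E. a s e * (d(e0 := x)) e) = a s e0 * x + (\<Sum>e\<in>E - {e0}. a s e * d e)"
        using insert.prems(1) e0 by (subst sum.remove[of _ e0]) (auto intro!: sum.cong)
      also have "\<dots> = (\<Sum>e\<in>E - {e0}. b s e * d e)"
        by (simp add: b_def x_def left_diff_distrib sum_subtractf sum_distrib_left
            sum_divide_distrib mult.assoc)
      finally show ?thesis .
    qed
    have "(\<Sum>e\<in>E - {e0}. b r e * d e) = 0" using e0 by (simp add: b_def)
    then have "\<forall>s\<in>insert r R. (\<Sum>e\<in>E. a s e * (d(e0 := x)) e) = 0"
      unfolding total using d(2) by simp
    moreover have "\<exists>e\<in>E. (d(e0 := x)) e \<noteq> 0" using d(1) by auto
    ultimately show ?thesis by blast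
  qed
qed

text \<open>
  In a 2-regular graph the edge incidences determine how \<open>d\<close> behaves: its absolute value is preserved
  when passing through a vertex other than \<open>v0\<close>. Counting the edges with absolute value \<open>\<bar>d p\<bar>\<close>, where
  \<open>p\<close> is an edge at \<open>v0\<close>, shows that both edges at \<open>v0\<close> have this absolute value, so each of them has
  \<open>d = 1 / 2\<close>. The edges with \<open>\<bar>d\<bar> = 1 / 2\<close> then form a union of components, and the number of these edges
  is even because every component has an even number of vertices. So the sum of \<open>d\<close> over them is an
  integer. But twice this sum is the total defect \<open>1\<close>.
\<close>

lemma two_regular_no_unit_defect:
  fixes d :: "'e \<Rightarrow> real"
  assumes g: "multigraph V E ends" and two: "\<And>v. v \<in> V \<Longrightarrow> card (cut E ends {v}) = 2"
    and cuts: "\<And>S. S \<subseteq> V \<Longrightarrow> odd (card S) \<Longrightarrow> cut E ends S \<noteq> {}"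
    and v0: "v0 \<in> V"
    and d: "\<And>v. v \<in> V \<Longrightarrow> sum d (cut E ends {v}) = (if v = v0 then 1 else 0)"
  shows False
proof -
  have fin: "finite V" "finite E" using g by (auto simp: multigraph_def)
  define A where "A a = {e \<in> E. \<bar>d e\<bar> = a}" for a
  have AE: "A a \<subseteq> E" for a by (auto simp: A_def)
  have other: "cut (A a) ends {v} = {} \<or> cut (A a) ends {v} = cut E ends {v}"
    if v: "v \<in> V" "v \<noteq> v0" for v a
  proof -
    obtain e1 e2 where e: "cut E ends {v} = {e1, e2}" "e1 \<noteq> e2"
      using two[OF v(1)] by (auto simp: card_2_iff)
    then have "\<bar>d e1\<bar> = \<bar>d e2\<bar>" using d[OF v(1)] v(2) by simp
    then show ?thesis
      unfolding cut_inter[OF AE] e using e cut_subset[of E ends "{v}"] by (auto simp: A_def)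
  qed
  obtain p q where pq: "cut E ends {v0} = {p, q}" "p \<noteq> q"
    using two[OF v0] by (auto simp: card_2_iff)
  have pqE: "p \<in> E" "q \<in> E" using pq cut_subset[of E ends "{v0}"] by auto
  have half: "d p = 1 / 2" "d q = 1 / 2"
  proof -
    let ?F = "A \<bar>d p\<bar>"
    have "2 * card ?F = (\<Sum>v\<in>V. card (cut ?F ends {v}))"
      using handshake[OF g AE, of "\<lambda>_. 1::nat"] by simp
    also have "\<dots> = card (cut ?F ends {v0}) + (\<Sum>v\<in>V - {v0}. card (cut ?F ends {v}))"
      using fin v0 by (simp add: sum.remove)
    finally have "2 * card ?F = card (cut ?F ends {v0}) + (\<Sum>v\<in>V - {v0}. card (cut ?F ends {v}))" .
    moreover have "even (\<Sum>v\<in>V - {v0}. card (cut ?F ends {v}))"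
    proof (rule dvd_sum)
      fix v assume "v \<in> V - {v0}"
      then have "card (cut ?F ends {v}) = 0 \<or> card (cut ?F ends {v}) = 2"
        using other[of v "\<bar>d p\<bar>"] two[of v] by auto
      then show "even (card (cut ?F ends {v}))" by auto
    qed
    ultimately have "even (card (cut ?F ends {v0}))"
      by (metis dvd_triv_left even_add)
    moreover have "cut ?F ends {v0} = {p, q} \<inter> ?F"
      using cut_inter[OF AE, of "\<bar>d p\<bar>" ends "{v0}"] pq by auto
    ultimately have "q \<in> ?F" using pqE by (auto simp: A_def split: if_splits)
    then have "\<bar>d p\<bar> = \<bar>d q\<bar>" by (simp add: A_def)
    moreover have "d p + d q = 1" using d[OF v0] pq by simp
    ultimately show "d p = 1 / 2" "d q = 1 / 2" by auto
  qed
  define F where "F = A (1 / 2)"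
  have FE: "F \<subseteq> E" using AE by (simp add: F_def)
  have all_or_none: "cut F ends {v} = {} \<or> cut F ends {v} = cut E ends {v}" if "v \<in> V" for v
  proof (cases "v = v0")
    case True
    then show ?thesis
      using cut_inter[OF FE, of ends "{v0}"] pq pqE half by (auto simp: F_def A_def)
  qed (use other that in \<open>simp add: F_def\<close>)
  define U where "U = {v \<in> V. cut F ends {v} = cut E ends {v}}"
  have nonempty: "cut E ends {v} \<noteq> {}" if "v \<in> V" for v using two[OF that] by auto
  have v0U: "v0 \<in> U"
    using v0 cut_inter[OF FE, of ends "{v0}"] pq pqE half by (auto simp: U_def F_def A_def)
  have "cut E ends U = {}"
  proof (rule ccontr)
    assume "cut E ends U \<noteq> {}"
    then obtain e x y where e: "e \<in> E" "x \<in> ends e" "x \<in> U" "y \<in> ends e" "y \<notin> U"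
      by (auto simp: cut_def)
    have "e \<in> cut E ends {x}" "e \<in> cut E ends {y}" "y \<in> V"
      using e g by (auto simp: cut_single[OF g order_refl] multigraph_def)
    moreover have "e \<in> F" using calculation(1) e(3) cut_subset[of F] by (auto simp: U_def)
    ultimately have "cut F ends {y} \<noteq> {}" by (auto simp: cut_def)
    then show False using all_or_none[OF \<open>y \<in> V\<close>] e(5) \<open>y \<in> V\<close> by (auto simp: U_def)
  qed
  then have evenU: "even (card U)" using cuts[of U] by (auto simp: U_def)
  have UV: "U \<subseteq> V" by (auto simp: U_def)
  have sumU: "(\<Sum>v\<in>V. sum f (cut F ends {v})) = (\<Sum>v\<in>U. sum f (cut E ends {v}))"
    for f :: "'e \<Rightarrow> 'b::comm_monoid_add"
  proof -
    have "cut F ends {v} = {}" if "v \<in> V - U" for v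
      using all_or_none[of v] that unfolding U_def by blast
    then have "(\<Sum>v\<in>U. sum f (cut F ends {v})) = (\<Sum>v\<in>V. sum f (cut F ends {v}))"
      using fin UV by (intro sum.mono_neutral_left) simp_all
    then show ?thesis by (simp add: U_def)
  qed
  have "2 * card F = (\<Sum>v\<in>U. card (cut E ends {v}))"
    using handshake[OF g FE, of "\<lambda>_. 1::nat"] sumU[of "\<lambda>_. 1::nat"] by simp
  also have "\<dots> = 2 * card U"
    using two UV by (simp add: subset_iff)
  finally have evenF: "even (card F)" using evenU by simp
  have "2 * sum d F = (\<Sum>v\<in>U. sum d (cut E ends {v}))"
    using handshake[OF g FE, of d] sumU[of d] by simp
  also have "\<dots> = (\<Sum>v\<in>U. if v = v0 then 1 else 0)"
    using UV by (intro sum.cong refl d) auto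
  also have "\<dots> = 1" using v0U finite_subset[OF UV fin(1)] by simp
  finally have one: "2 * sum d F = 1" .
  have finF: "finite F" using FE fin(2) by (rule finite_subset)
  define P where "P = {e \<in> F. d e > 0}"
  have PF: "P \<subseteq> F" by (auto simp: P_def)
  have "sum d F = sum d (F - P) + sum d P" using sum.subset_diff[OF PF finF] .
  also have "sum d P = (\<Sum>e\<in>P. 1 / 2)" by (intro sum.cong) (auto simp: P_def F_def A_def)
  also have "sum d (F - P) = (\<Sum>e\<in>F - P. - 1 / 2)" by (intro sum.cong) (auto simp: P_def F_def A_def)
  finally have "2 * sum d F = real (card P) - real (card (F - P))" by simp
  then have "real (card P) = real (card (F - P) + 1)" using one by simp
  then have "card P = card (F - P) + 1" by linarith
  moreover have "card F = card P + card (F - P)"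
    using finF PF by (simp add: card_Diff_subset finite_subset card_mono)
  ultimately show False using evenF by simp
qed

text \<open>
  Every vertex has at least two edges, since a single edge would have weight \<open>1\<close>. So there are at
  least as many edges as vertices. If there are more, the vertex equations have a nonzero solution by
  counting unknowns. If the numbers are equal, the graph is 2-regular; omitting the equation
  at one vertex \<open>v0\<close> gives a nonzero solution, and the omitted equation holds as well because of
  \<open>two_regular_no_unit_defect\<close>.
\<close>

lemma balanced_perturbation:
  assumes g: "multigraph V E ends" and w: "fractional_matching V E ends w"
    and pos: "\<And>e. e \<in> E \<Longrightarrow> 0 < w e" and ne1: "\<And>e. e \<in> E \<Longrightarrow> w e \<noteq> 1" and V: "V \<noteq> {}"
  shows "\<exists>d :: 'e \<Rightarrow> real. (\<exists>e\<in>E. d e \<noteq> 0) \<and> (\<forall>v\<in>V. sum d (cut E ends {v}) = 0)"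
proof (rule ccontr)
  assume none: "\<not> ?thesis"
  have fin: "finite V" "finite E" using g by (auto simp: multigraph_def)
  \<comment> \<open>The incidence matrix.\<close>
  define a :: "'a \<Rightarrow> 'e \<Rightarrow> real" where "a v e = (if v \<in> ends e then 1 else 0)" for v e
  have a: "(\<Sum>e\<in>E. a v e * d e) = sum d (cut E ends {v})" for v d
  proof -
    have "(\<Sum>e\<in>E. a v e * d e) = (\<Sum>e\<in>E. if v \<in> ends e then d e else 0)"
      by (intro sum.cong) (auto simp: a_def)
    then show ?thesis
      using fin(2) by (simp add: cut_single[OF g order_refl] sum.inter_filter)
  qed
  have deg: "2 \<le> card (cut E ends {v})" if "v \<in> V" for v
  proof (rule ccontr)
    assume "\<not> ?thesis"
    then have "card (cut E ends {v}) = 0 \<or> card (cut E ends {v}) = 1" by linarith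
    moreover have "sum w (cut E ends {v}) = 1" using w that by (simp add: fractional_matching_def)
    ultimately show False
      using ne1 cut_subset[of E ends "{v}"] fin by (auto simp: card_1_singleton_iff)
  qed
  have hs: "(\<Sum>v\<in>V. card (cut E ends {v})) = 2 * card E"
    using handshake[OF g order_refl, of "\<lambda>_. 1::nat"] by simp
  have "\<not> card V < card E"
    using underdetermined_system[OF fin, of a] none unfolding a by auto
  moreover have "(\<Sum>v\<in>V. 2) \<le> (\<Sum>v\<in>V. card (cut E ends {v}))"
    by (intro sum_mono deg)
  ultimately have eq: "card V = card E" using hs by simp
  have two: "card (cut E ends {v}) = 2" if "v \<in> V" for v
  proof (rule ccontr)
    assume "card (cut E ends {v}) \<noteq> 2"
    then have "(\<Sum>v\<in>V. 2) < (\<Sum>v\<in>V. card (cut E ends {v}))"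
      using deg that fin by (intro sum_strict_mono_ex1) (auto simp: le_less)
    then show False using eq hs by simp
  qed
  obtain v0 where v0: "v0 \<in> V" using V by blast
  have "card (V - {v0}) < card E" using eq v0 fin by (metis card_Diff1_less)
  from underdetermined_system[OF finite_Diff[OF fin(1)] fin(2) this, of a]
  obtain d :: "'e \<Rightarrow> real" where d1: "\<exists>e\<in>E. d e \<noteq> 0" and "\<forall>v\<in>V - {v0}. sum d (cut E ends {v}) = 0"
    unfolding a by (elim exE conjE)
  then have d2: "\<And>v. v \<in> V - {v0} \<Longrightarrow> sum d (cut E ends {v}) = 0" by blast
  define s where "s = sum d (cut E ends {v0})"
  have s: "s \<noteq> 0" using none d1 d2 v0 unfolding s_def by (metis Diff_iff singletonD)
  have cuts: "cut E ends S \<noteq> {}" if "S \<subseteq> V" "odd (card S)" for S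
  proof -
    have "1 \<le> sum w (cut E ends S)" using w that by (simp add: fractional_matching_def)
    then show ?thesis by auto
  qed
  have defect: "sum (\<lambda>e. d e / s) (cut E ends {v}) = (if v = v0 then 1 else 0)" if "v \<in> V" for v
    using d2[of v] that s by (auto simp: sum_divide_distrib[symmetric] s_def)
  show False by (rule two_regular_no_unit_defect[OF g two cuts v0 defect])
qed

text \<open>
  The ratio test of the simplex method. It matters later that the constraint that becomes tight was
  a decreasing one.
\<close>

lemma first_tight_constraint:
  fixes a b :: "'i \<Rightarrow> real"
  assumes I: "finite I" and a: "\<And>i. i \<in> I \<Longrightarrow> 0 \<le> a i" and b: "\<exists>i\<in>I. b i < 0"
  shows "\<exists>t\<ge>0. (\<forall>i\<in>I. 0 \<le> a i + t * b i) \<and> (\<exists>i\<in>I. b i < 0 \<and> a i + t * b i = 0)"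
proof -
  define J where "J = {i \<in> I. b i < 0}"
  define T where "T = (\<lambda>i. a i / - b i) ` J"
  have T: "finite T" "T \<noteq> {}" using I b by (auto simp: T_def J_def)
  have t0: "0 \<le> Min T" using T a by (auto simp: T_def J_def divide_le_0_iff)
  have "0 \<le> a i + Min T * b i" if i: "i \<in> I" for i
  proof (cases "b i < 0")
    case True
    then have "Min T \<le> a i / - b i" using T i by (auto simp: T_def J_def)
    then show ?thesis using True by (simp add: field_simps)
  qed (use t0 a[OF i] in simp)
  moreover obtain i where "i \<in> J" "Min T = a i / - b i"
    using Min_in[OF T] by (auto simp: T_def)
  ultimately show ?thesis
    using t0 by (intro exI[of _ "Min T"]) (auto simp: J_def intro!: bexI[of _ i])
qed

text \<open>
  Edmonds' perfect matching polytope theorem, in its optimisation form: for every linear objective,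
  the polytope contains no point that is better than all perfect matchings.
\<close>

theorem matching_polytope:
  fixes c w :: "'e \<Rightarrow> real"
  assumes "multigraph V E ends" and "fractional_matching V E ends w"
  shows "\<exists>M. matching V E ends M \<and> (\<Sum>e\<in>E. c e * w e) \<le> sum c M"
  using assms
proof (induction "card V + card E" arbitrary: V E ends w c rule: less_induct)
  case less
  note g = less.prems(1) and w = less.prems(2)
  have fin: "finite V" "finite E" using g by (auto simp: multigraph_def)
  have endsV: "ends e \<subseteq> V" if "e \<in> E" for e using g that by (auto simp: multigraph_def)
  have evenV: "even (card V)"
  proof (rule ccontr)
    assume "odd (card V)"
    then have "1 \<le> sum w (cut E ends V)" using w by (simp add: fractional_matching_def)
    moreover have "cut E ends V = {}" using endsV by (auto simp: cut_def)
    ultimately show False by simp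
  qed
  have zero_edge: "\<exists>M. matching V E ends M \<and> (\<Sum>e\<in>E. c e * w e) \<le> sum c M"
    if w: "fractional_matching V E ends w" and e: "e \<in> E" "w e = 0" for w e
  proof -
    have "cut (E - {e}) ends S = cut E ends S - {e}" for S by (auto simp: cut_def)
    then have "sum w (cut (E - {e}) ends S) = sum w (cut E ends S)" for S
      using e fin by (auto intro!: sum.mono_neutral_left)
    then have "fractional_matching V (E - {e}) ends w"
      using w by (simp add: fractional_matching_def)
    moreover have "multigraph V (E - {e}) ends" using g by (simp add: multigraph_def)
    moreover have "card V + card (E - {e}) < card V + card E"
      using card_Diff1_less[OF fin(2) e(1)] by simp
    ultimately obtain M where M: "matching V (E - {e}) ends M" "(\<Sum>e\<in>E - {e}. c e * w e) \<le> sum c M"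
      using less.hyps by blast
    moreover have "(\<Sum>e\<in>E - {e}. c e * w e) = (\<Sum>e\<in>E. c e * w e)"
      using e fin by (intro sum.mono_neutral_left) auto
    ultimately show ?thesis by (auto simp: matching_def)
  qed
  have tight_cut: "\<exists>M. matching V E ends M \<and> (\<Sum>e\<in>E. c e * w e) \<le> sum c M"
    if w: "fractional_matching V E ends w" and S: "S \<subseteq> V" "odd (card S)" "sum w (cut E ends S) = 1"
      and big: "card S \<noteq> 1" "card (V - S) \<noteq> 1" for w S
  proof -
    have finS: "finite S" using S fin by (auto intro: finite_subset)
    have cardVS: "card V = card S + card (V - S)"
      using S(1) fin finS by (simp add: card_Diff_subset card_mono)
    then have odd': "odd (card (V - S))" using evenV S(2) by simp
    have gt: "1 < card S" "1 < card (V - S)"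
      using S(2) odd' big by (metis One_nat_def dvd_0_right less_one linorder_neqE_nat)+
    then obtain u z where u: "u \<in> S" and z: "z \<in> V - S"
      by (metis card.empty ex_in_conv not_less_zero)
    have VS: "V - (V - S) = S" using S by blast
    have tight': "sum w (cut E ends (V - S)) = 1" using cut_complement[OF g, of S] S(3) by simp
    note g1 = contraction[OF g w S(1) u S(2,3)]
    note g2 = contraction[OF g w Diff_subset z odd' tight', unfolded VS]
    have small: "card (insert u (V - S)) < card V" "card (insert z S) < card V"
      using cardVS gt u z fin finS by (simp_all)
    have "card {e \<in> E. \<not> ends e \<subseteq> S} \<le> card E" "card {e \<in> E. \<not> ends e \<subseteq> V - S} \<le> card E"
      using fin by (auto intro: card_mono)
    then show ?thesis
      using small
      by (intro glue_across_tight_cut[OF g w S(1,2) odd' S(3) u z]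
          less.hyps[OF _ g1] less.hyps[OF _ g2]) auto
  qed
  show ?case
  proof (cases "V = {}")
    case True
    then have "E = {}" using edge_ends[OF g] by blast
    then show ?thesis using True by (auto simp: matching_def)
  next
    case False
    show ?thesis
    proof (cases "\<exists>e\<in>E. w e = 0")
      case True
      then show ?thesis using zero_edge[OF w] by blast
    next
      case nonzero: False
      then have pos: "\<And>e. e \<in> E \<Longrightarrow> 0 < w e"
        using w by (auto simp: fractional_matching_def less_le)
      show ?thesis
      proof (cases "\<exists>e\<in>E. w e = 1")
        case True
        then obtain e where e: "e \<in> E" "w e = 1" by blast
        obtain u v where uv: "ends e = {u, v}" "u \<noteq> v" "u \<in> V" "v \<in> V"
          using edge_ends[OF g e(1)] .
        have only: "cut E ends {x} = {e}" if "x \<in> ends e" for x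
        proof -
          have x: "x \<in> V" "e \<in> cut E ends {x}"
            using that e endsV by (auto simp: cut_single[OF g order_refl])
          have "sum w (cut E ends {x}) = w e + sum w (cut E ends {x} - {e})"
            using x(2) fin by (simp add: sum.remove)
          then have "sum w (cut E ends {x} - {e}) = 0"
            using w x(1) e(2) by (simp add: fractional_matching_def)
          then have "\<forall>f\<in>cut E ends {x} - {e}. w f = 0"
            using fin pos cut_subset[of E ends] by (subst (asm) sum_nonneg_eq_0_iff) (auto intro: less_imp_le)
          then have "cut E ends {x} - {e} = {}" using nonzero cut_subset[of E ends] by blast
          then show ?thesis using x(2) by blast
        qed
        let ?V = "V - {u, v}" and ?E = "E - {e}"
        have apart: "ends f \<inter> {u, v} = {}" if "f \<in> ?E" for f
          using only[of u] only[of v] that uv by (auto simp: cut_single[OF g order_refl])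
        have g': "multigraph ?V ?E ends"
          using g apart unfolding multigraph_def by blast
        have same: "cut ?E ends S = cut E ends S" if "S \<subseteq> ?V" for S
          using that uv by (auto simp: cut_def)
        have w': "fractional_matching ?V ?E ends w"
          unfolding fractional_matching_def
        proof (intro conjI ballI allI impI)
          fix x assume "x \<in> ?V"
          then show "sum w (cut ?E ends {x}) = 1"
            using same[of "{x}"] w by (simp add: fractional_matching_def)
        next
          fix S assume "S \<subseteq> ?V" "odd (card S)"
          moreover from this have "S \<subseteq> V" by blast
          ultimately show "1 \<le> sum w (cut ?E ends S)"
            using same[of S] w by (simp add: fractional_matching_def)
        qed (use w in \<open>simp add: fractional_matching_def\<close>)
        have "card ?V \<le> card V" using fin by (intro card_mono) auto
        moreover have "card ?E < card E" using fin(2) e(1) by (rule card_Diff1_less)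
        ultimately obtain M where M: "matching ?V ?E ends M" "(\<Sum>e\<in>?E. c e * w e) \<le> sum c M"
          using less.hyps[OF _ g' w'] by (metis add_le_less_mono)
        have MS: "M \<subseteq> ?E" using M by (simp add: matching_def)
        have "card (cut (insert e M) ends {x}) = 1" if "x \<in> V" for x
        proof (cases "x \<in> ends e")
          case True
          have "cut (insert e M) ends {x} = {e}"
            using only[OF True] cut_inter[of "insert e M" E ends "{x}"] MS e by auto
          then show ?thesis by simp
        next
          case False
          then have "cut (insert e M) ends {x} = cut M ends {x}" by (auto simp: cut_def)
          then show ?thesis using M(1) False that uv by (simp add: matching_def)
        qed
        then have "matching V E ends (insert e M)" using MS e by (auto simp: matching_def)
        moreover have "sum c (insert e M) = c e + sum c M"
          using MS fin by (subst sum.insert) (auto intro: finite_subset)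
        moreover have "(\<Sum>e\<in>E. c e * w e) = c e + (\<Sum>e\<in>?E. c e * w e)"
          using e fin by (simp add: sum.remove)
        ultimately show ?thesis using M(2) by (intro exI[of _ "insert e M"]) simp
      next
        case False
        then have ne1: "\<And>e. e \<in> E \<Longrightarrow> w e \<noteq> 1" by blast
        have "\<exists>d :: 'e \<Rightarrow> real. (\<exists>e\<in>E. d e \<noteq> 0) \<and> (\<forall>v\<in>V. sum d (cut E ends {v}) = 0)"
          by (rule balanced_perturbation[OF g w pos ne1 \<open>V \<noteq> {}\<close>])
        then obtain d0 :: "'e \<Rightarrow> real" where d0: "\<exists>e\<in>E. d0 e \<noteq> 0" "\<forall>v\<in>V. sum d0 (cut E ends {v}) = 0"
          by (elim exE conjE)
        \<comment> \<open>The sign is chosen so that moving along \<open>d\<close> does not decrease the objective.\<close>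
        define d where "d = (if 0 \<le> (\<Sum>e\<in>E. c e * d0 e) then d0 else (\<lambda>e. - d0 e))"
        have d: "\<exists>e\<in>E. d e \<noteq> 0" "\<And>v. v \<in> V \<Longrightarrow> sum d (cut E ends {v}) = 0"
          using d0 by (auto simp: d_def sum_negf)
        have gain: "0 \<le> (\<Sum>e\<in>E. c e * d e)" by (auto simp: d_def sum_negf)
        have neg: "\<exists>e\<in>E. d e < 0"
        proof (rule ccontr)
          assume "\<not> ?thesis"
          then have d_nonneg: "\<And>e. e \<in> E \<Longrightarrow> 0 \<le> d e" by force
          obtain e where e: "e \<in> E" "d e \<noteq> 0" using d(1) by blast
          obtain v where v: "v \<in> ends e" "v \<in> V" using edge_ends[OF g e(1)] by (metis insertI1)
          have "\<forall>f\<in>cut E ends {v}. d f = 0"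
            using d(2)[OF v(2)] fin d_nonneg cut_subset[of E ends]
            by (subst (asm) sum_nonneg_eq_0_iff) auto
          then show False using e v by (auto simp: cut_single[OF g order_refl])
        qed
        \<comment> \<open>The constraints: nonnegativity of each edge weight and one inequality for each odd set.\<close>
        define I where "I = E <+> {S. S \<subseteq> V \<and> odd (card S)}"
        define slack where "slack = case_sum w (\<lambda>S. sum w (cut E ends S) - 1)"
        define rate where "rate = case_sum d (\<lambda>S. sum d (cut E ends S))"
        have "finite I" using fin by (simp add: I_def)
        moreover have "0 \<le> slack i" if "i \<in> I" for i
          using that w by (auto simp: I_def slack_def fractional_matching_def)
        moreover have "\<exists>i\<in>I. rate i < 0" using neg by (force simp: I_def rate_def)
        ultimately obtain t i where t: "0 \<le> t" "\<And>i. i \<in> I \<Longrightarrow> 0 \<le> slack i + t * rate i"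
          and i: "i \<in> I" "rate i < 0" "slack i + t * rate i = 0"
          using first_tight_constraint[of I slack rate] by blast
        define w' where "w' e = w e + t * d e" for e
        have sum_w': "sum w' F = sum w F + t * sum d F" for F
          by (simp add: w'_def sum.distrib sum_distrib_left)
        have w'_frac: "fractional_matching V E ends w'"
          unfolding fractional_matching_def
        proof (intro conjI ballI allI impI)
          show "0 \<le> w' e" if "e \<in> E" for e
          proof -
            have "Inl e \<in> I" using that unfolding I_def by (rule InlI)
            from t(2)[OF this] show ?thesis by (simp add: slack_def rate_def w'_def)
          qed
          show "sum w' (cut E ends {v}) = 1" if "v \<in> V" for v
            using w d(2)[OF that] that by (simp add: sum_w' fractional_matching_def)
          show "1 \<le> sum w' (cut E ends S)" if "S \<subseteq> V" "odd (card S)" for S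
          proof -
            have "Inr S \<in> I" unfolding I_def by (rule InrI) (use that in simp)
            from t(2)[OF this] show ?thesis by (simp add: slack_def rate_def sum_w')
          qed
        qed
        have "(\<Sum>e\<in>E. c e * w' e) = (\<Sum>e\<in>E. c e * w e) + t * (\<Sum>e\<in>E. c e * d e)"
          by (simp add: w'_def algebra_simps sum.distrib sum_distrib_left)
        then have better: "(\<Sum>e\<in>E. c e * w e) \<le> (\<Sum>e\<in>E. c e * w' e)"
          using gain t(1) by simp
        have "\<exists>M. matching V E ends M \<and> (\<Sum>e\<in>E. c e * w' e) \<le> sum c M"
        proof (cases i)
          case (Inl e)
          then show ?thesis
            using i by (intro zero_edge[OF w'_frac, of e]) (auto simp: I_def slack_def rate_def w'_def)
        next
          case (Inr S)
          then have S: "S \<subseteq> V" "odd (card S)" "sum d (cut E ends S) < 0" "sum w' (cut E ends S) = 1"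
            using i by (auto simp: I_def slack_def rate_def sum_w')
          have "card S \<noteq> 1" using S d(2) by (auto simp: card_1_singleton_iff)
          moreover have "card (V - S) \<noteq> 1"
          proof
            assume "card (V - S) = 1"
            then obtain v where "V - S = {v}" by (auto simp: card_1_singleton_iff)
            then show False using d(2)[of v] S(3) cut_complement[OF g, of S] by force
          qed
          \<comment> \<open>The tight set and its complement are not single vertices, as \<open>d\<close> is negative on its cut
              but vanishes on the cut of a vertex.\<close>
          ultimately show ?thesis by (intro tight_cut[OF w'_frac S(1,2,4)])
        qed
        then show ?thesis using better by force
      qed
    qed
  qed
qed

text \<open>
  A perfect matching has at least one edge in every odd cut. Subtracting a large multiple \<open>K\<close> of the
  number of tight odd cuts that contain an edge from its objective value penalises every further
  edge; \<open>K\<close> exceeds every possible gain in \<open>c\<close>, so a matching that does as well as \<open>w\<close> for the new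
  objective has exactly one edge in each tight cut.
\<close>

lemma matching_meeting_tight_cuts_once:
  fixes c w :: "'e \<Rightarrow> real"
  assumes g: "multigraph V E ends" and w: "fractional_matching V E ends w"
  shows "\<exists>M. matching V E ends M \<and> (\<Sum>e\<in>E. c e * w e) \<le> sum c M \<and>
    (\<forall>S\<subseteq>V. odd (card S) \<longrightarrow> sum w (cut E ends S) = 1 \<longrightarrow> card (cut M ends S) = 1)"
proof -
  have fin: "finite V" "finite E" using g by (auto simp: multigraph_def)
  define T where "T = {S. S \<subseteq> V \<and> odd (card S) \<and> sum w (cut E ends S) = 1}"
  define K where "K = (\<Sum>e\<in>E. \<bar>c e\<bar>) + \<bar>\<Sum>e\<in>E. c e * w e\<bar> + 1"
  define c' where "c' e = c e - K * (\<Sum>S\<in>T. if e \<in> cut E ends S then 1 else 0)" for e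
  have finT: "finite T" using fin by (simp add: T_def)
  obtain M where M: "matching V E ends M" "(\<Sum>e\<in>E. c' e * w e) \<le> sum c' M"
    using matching_polytope[OF g w] by blast
  have MS: "M \<subseteq> E" using M by (simp add: matching_def)
  have finM: "finite M" using MS fin(2) by (rule finite_subset)
  have "(\<Sum>e\<in>E. (\<Sum>S\<in>T. if e \<in> cut E ends S then 1 else 0) * w e) =
      (\<Sum>e\<in>E. \<Sum>S\<in>T. if e \<in> cut E ends S then w e else 0)"
    by (auto simp: sum_distrib_right intro!: sum.cong)
  also have "\<dots> = (\<Sum>S\<in>T. \<Sum>e\<in>E. if e \<in> cut E ends S then w e else 0)"
    by (rule sum.swap)
  also have "\<dots> = (\<Sum>S\<in>T. 1)"
  proof (rule sum.cong[OF refl])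
    fix S assume "S \<in> T"
    moreover have "E \<inter> cut E ends S = cut E ends S" using cut_subset[of E ends S] by blast
    ultimately show "(\<Sum>e\<in>E. if e \<in> cut E ends S then w e else 0) = 1"
      using fin by (simp add: T_def sum.If_cases)
  qed
  finally have "(\<Sum>e\<in>E. c' e * w e) = (\<Sum>e\<in>E. c e * w e) - K * real (card T)"
    by (simp add: c'_def left_diff_distrib sum_subtractf mult.assoc sum_distrib_left[symmetric])
  moreover have "sum c' M = sum c M - K * (\<Sum>S\<in>T. real (card (cut M ends S)))"
  proof -
    have "(\<Sum>e\<in>M. \<Sum>S\<in>T. if e \<in> cut E ends S then 1 else 0) = (\<Sum>S\<in>T. \<Sum>e\<in>M. if e \<in> cut E ends S then 1 else 0)"
      by (rule sum.swap)
    also have "\<dots> = (\<Sum>S\<in>T. real (card (cut M ends S)))"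
      using finM by (simp add: sum.If_cases cut_inter[OF MS])
    finally show ?thesis by (simp add: c'_def sum_subtractf sum_distrib_left[symmetric])
  qed
  ultimately have le: "(\<Sum>e\<in>E. c e * w e) + K * ((\<Sum>S\<in>T. real (card (cut M ends S))) - real (card T)) \<le> sum c M"
    using M(2) by (simp add: algebra_simps)
  have one: "1 \<le> card (cut M ends S)" if "S \<in> T" for S
    using matching_parity[OF g M(1), of S] that by (auto simp: T_def Suc_le_eq intro!: Nat.gr0I)
  have "sum c M \<le> (\<Sum>e\<in>M. \<bar>c e\<bar>)" by (intro sum_mono) simp
  also have "\<dots> \<le> (\<Sum>e\<in>E. \<bar>c e\<bar>)" using MS fin by (intro sum_mono2) auto
  finally have lt: "sum c M - (\<Sum>e\<in>E. c e * w e) < K" by (simp add: K_def)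
  have ge: "card T \<le> (\<Sum>S\<in>T. card (cut M ends S))"
    using sum_mono[of T "\<lambda>_. 1" "\<lambda>S. card (cut M ends S)"] one by simp
  have eq: "(\<Sum>S\<in>T. card (cut M ends S)) = card T"
  proof (rule ccontr)
    assume "(\<Sum>S\<in>T. card (cut M ends S)) \<noteq> card T"
    with ge have "card T + 1 \<le> (\<Sum>S\<in>T. card (cut M ends S))" by simp
    then have excess: "1 \<le> (\<Sum>S\<in>T. real (card (cut M ends S))) - real (card T)"
      by (simp flip: of_nat_sum)
    have "0 \<le> K" by (simp add: K_def sum_nonneg)
    then have "K * 1 \<le> K * ((\<Sum>S\<in>T. real (card (cut M ends S))) - real (card T))"
      using excess by (intro mult_left_mono)
    then show False using le lt by simp
  qed
  have all1: "card (cut M ends S) = 1" if "S \<in> T" for S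
  proof (rule ccontr)
    assume "card (cut M ends S) \<noteq> 1"
    then have "(\<Sum>S\<in>T. 1) < (\<Sum>S\<in>T. card (cut M ends S))"
      using one[OF that] one finT that by (intro sum_strict_mono_ex1) (auto intro!: bexI[of _ S] simp: le_less)
    then show False using eq by simp
  qed
  have "real (card T) = (\<Sum>S\<in>T. real (card (cut M ends S)))"
    using eq by (simp flip: of_nat_sum)
  then have "(\<Sum>e\<in>E. c e * w e) \<le> sum c M" using le by simp
  then show ?thesis using M(1) all1 by (auto simp: T_def)
qed

section \<open>Odd cuts and the number of edges of a cubic graph\<close>

lemma multigraph_of_simple_graph:
  assumes "finite_simple_graph V E"
  shows "multigraph V E (\<lambda>e. e)"
proof -
  have "E \<subseteq> Pow V" using assms by (auto simp: finite_simple_graph_def)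
  then show ?thesis
    using assms by (auto simp: finite_simple_graph_def multigraph_def intro: finite_subset)
qed

lemma degree_eq_card_cut:
  assumes "finite_simple_graph V E" "F \<subseteq> E"
  shows "degree F v = card (cut F (\<lambda>e. e) {v})"
  using cut_single[OF multigraph_of_simple_graph[OF assms(1)] assms(2)] by (simp add: degree_def)

lemma perfect_matching_iff:
  assumes "finite_simple_graph V E"
  shows "perfect_matching V E M \<longleftrightarrow> matching V E (\<lambda>e. e) M"
  using degree_eq_card_cut[OF assms]
  by (auto simp: perfect_matching_def matching_def regular_def)

lemma connected_imp_cut_nonempty:
  assumes "graph_connected V F" "x \<in> V" "x \<in> S" "y \<in> V" "y \<notin> S"
  shows "cut F (\<lambda>e. e) S \<noteq> {}"
proof
  assume none: "cut F (\<lambda>e. e) S = {}"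
  have "(x, y) \<in> {(x, y). {x, y} \<in> F}\<^sup>*" using assms by (simp add: graph_connected_def)
  then have "y \<in> S"
  proof induction
    case base
    show ?case using assms(3) .
  next
    case (step a b)
    then have "{a, b} \<in> F" "a \<in> S" by auto
    then show ?case using none by (auto simp: cut_def)
  qed
  then show False using assms(5) by contradiction
qed

lemma odd_cut_cubic:
  assumes G: "finite_simple_graph V E" "cubic V E" and S: "S \<subseteq> V" "odd (card S)"
  shows "odd (card (cut E (\<lambda>e. e) S))"
proof -
  have "(\<Sum>v\<in>S. card (cut E (\<lambda>e. e) {v})) =
      2 * card {e \<in> E. e \<subseteq> S} + card (cut E (\<lambda>e. e) S)"
    using sum_stars[OF multigraph_of_simple_graph[OF G(1)] order_refl S(1), of "\<lambda>_. 1::nat"] by simp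
  moreover have "(\<Sum>v\<in>S. card (cut E (\<lambda>e. e) {v})) = (\<Sum>v\<in>S. 3)"
    using G S degree_eq_card_cut[OF G(1) order_refl]
    by (intro sum.cong) (auto simp: cubic_def regular_def)
  ultimately have "3 * card S = 2 * card {e \<in> E. e \<subseteq> S} + card (cut E (\<lambda>e. e) S)" by simp
  then show ?thesis using S(2) by presburger
qed

text \<open>
  By parity an odd cut of a cubic graph with fewer than three edges would consist of a single edge,
  and this edge would be a bridge.
\<close>

lemma odd_cut_at_least_three:
  assumes G: "finite_simple_graph V E" "cubic V E" "bridgeless V E" and S: "S \<subseteq> V" "odd (card S)"
  shows "3 \<le> card (cut E (\<lambda>e. e) S)"
proof -
  have odd: "odd (card (cut E (\<lambda>e. e) S))" by (rule odd_cut_cubic[OF G(1,2) S])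
  moreover have "card (cut E (\<lambda>e. e) S) \<noteq> 1"
  proof
    assume "card (cut E (\<lambda>e. e) S) = 1"
    then obtain e where e: "cut E (\<lambda>e. e) S = {e}" by (auto simp: card_1_singleton_iff)
    then have "e \<in> E" "e \<inter> S \<noteq> {}" "\<not> e \<subseteq> S" by (auto simp: cut_def)
    moreover from this have "e \<subseteq> V" using G(1) by (auto simp: finite_simple_graph_def)
    ultimately obtain x y where "x \<in> V" "x \<in> S" "y \<in> V" "y \<notin> S" by blast
    moreover have "graph_connected V (E - {e})"
      using G(3) \<open>e \<in> E\<close> by (simp add: bridgeless_def)
    ultimately have "cut (E - {e}) (\<lambda>e. e) S \<noteq> {}"
      using connected_imp_cut_nonempty by metis
    then show False using e by (auto simp: cut_def)
  qed
  ultimately show ?thesis by presburger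
qed

lemma cubic_at_least_six_edges:
  assumes G: "finite_simple_graph V E" "cubic V E" "V \<noteq> {}"
  shows "6 \<le> card E"
proof -
  have fin: "finite V" using G by (simp add: finite_simple_graph_def)
  obtain v where v: "v \<in> V" using G by blast
  have "{e \<in> E. v \<in> e} \<subseteq> (\<lambda>x. {v, x}) ` (V - {v})"
  proof
    fix e assume "e \<in> {e \<in> E. v \<in> e}"
    moreover from this have "card e = 2" "e \<subseteq> V" using G(1) by (auto simp: finite_simple_graph_def)
    ultimately show "e \<in> (\<lambda>x. {v, x}) ` (V - {v})" by (auto simp: card_2_iff)
  qed
  then have "card {e \<in> E. v \<in> e} \<le> card (V - {v})"
    using fin by (meson card_image_le card_mono finite_Diff finite_imageI le_trans)
  moreover have "card {e \<in> E. v \<in> e} = 3"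
    using G v by (simp add: cubic_def regular_def degree_def)
  ultimately have "4 \<le> card V" using v fin by (simp add: card_Diff_singleton)
  moreover have "(\<Sum>v\<in>V. card (cut E (\<lambda>e. e) {v})) = 2 * card E"
    using handshake[OF multigraph_of_simple_graph[OF G(1)] order_refl, of "\<lambda>_. 1::nat"] by simp
  moreover have "(\<Sum>v\<in>V. card (cut E (\<lambda>e. e) {v})) = (\<Sum>v\<in>V. 3)"
    using G degree_eq_card_cut[OF G(1) order_refl]
    by (intro sum.cong) (auto simp: cubic_def regular_def)
  ultimately show ?thesis by simp
qed

section \<open>Choosing the matchings one by one\<close>

definition multiplicity :: "'a set list \<Rightarrow> 'a \<Rightarrow> nat" where
  "multiplicity Ms e = length (filter (\<lambda>M. e \<in> M) Ms)"

lemma sum_multiplicity_Cons: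
  assumes "finite F"
  shows "sum (multiplicity (M # Ms)) F = card (M \<inter> F) + sum (multiplicity Ms) F"
proof -
  have "sum (multiplicity (M # Ms)) F = (\<Sum>e\<in>F. (if e \<in> M then 1 else 0) + multiplicity Ms e)"
    by (intro sum.cong) (auto simp: multiplicity_def)
  also have "\<dots> = card (M \<inter> F) + sum (multiplicity Ms) F"
    using assms by (simp add: sum.distrib sum.If_cases Int_commute)
  finally show ?thesis .
qed

text \<open>
  With \<open>k = length Ms\<close>, the inequality says that the weights
  \<open>(k + 1 - multiplicity Ms e) / (2 * k + 3)\<close> sum to at least \<open>1\<close> across every odd cut, cleared of
  denominators.
\<close>

definition cut_balanced :: "'v set \<Rightarrow> 'v set set \<Rightarrow> 'v set set list \<Rightarrow> bool" where
  "cut_balanced V E Ms \<longleftrightarrow> (\<forall>M\<in>set Ms. matching V E (\<lambda>e. e) M) \<and>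
     (\<forall>S\<subseteq>V. odd (card S) \<longrightarrow>
        2 * length Ms + 3 + sum (multiplicity Ms) (cut E (\<lambda>e. e) S)
          \<le> (length Ms + 1) * card (cut E (\<lambda>e. e) S))"

text \<open>
  For an odd cut \<open>C\<close> with multiplicity sum \<open>n\<close> the invariant reads \<open>2 * k + 3 + n \<le> (k + 1) * card C\<close>.
  Adding \<open>M\<close> raises the left side by \<open>2 + card (M \<inter> C)\<close> and the right side by \<open>card C\<close>. In case of
  equality the cut is tight, so that \<open>card (M \<inter> C) = 1\<close>, and \<open>3 \<le> card C\<close> suffices. In case of strict
  inequality the two sides have the same parity, hence differ by at least \<open>2\<close>, and
  \<open>card (M \<inter> C) \<le> card C\<close> suffices.
\<close>

lemma extend_cut_balanced:
  assumes G: "finite_simple_graph V E" "cubic V E" "bridgeless V E"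
    and bal: "cut_balanced V E Ms"
  obtains M where "cut_balanced V E (M # Ms)"
    "(2 * length Ms + 3) * card (E - \<Union>(set (M # Ms))) \<le> (length Ms + 2) * card (E - \<Union>(set Ms))"
proof -
  let ?cut = "cut E (\<lambda>e. e)"
  define k where "k = length Ms"
  define n where "n = multiplicity Ms"
  define w where "w e = (real k + 1 - real (n e)) / (2 * real k + 3)" for e
  define U where "U = E - \<Union>(set Ms)"
  note g = multigraph_of_simple_graph[OF G(1)]
  have fin: "finite E" using g by (simp add: multigraph_def)
  have finU: "finite U" using fin by (simp add: U_def)
  have D: "2 * real k + 3 > 0" by simp
  have star3: "card (?cut {v}) = 3" if "v \<in> V" for v
    using G(2) that degree_eq_card_cut[OF G(1) order_refl, of v] by (simp add: cubic_def regular_def)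
  have star_n: "sum n (?cut {v}) = k" if v: "v \<in> V" for v
  proof -
    have "\<forall>M\<in>set Ms. matching V E (\<lambda>e. e) M" using bal by (simp add: cut_balanced_def)
    then show ?thesis
      unfolding n_def k_def
    proof (induction Ms)
      case Nil
      then show ?case by (simp add: multiplicity_def)
    next
      case (Cons M Ms)
      have "M \<inter> ?cut {v} = cut M (\<lambda>e. e) {v}"
        using Cons.prems cut_inter[of M E "\<lambda>e. e" "{v}"] by (simp add: matching_def)
      then have "card (M \<inter> ?cut {v}) = 1" using Cons.prems v by (simp add: matching_def)
      then show ?case using Cons fin by (simp add: sum_multiplicity_Cons)
    qed
  qed
  have sum_w: "sum w F = ((real k + 1) * real (card F) - real (sum n F)) / (2 * real k + 3)" for F
    by (simp add: w_def sum_divide_distrib[symmetric] sum_subtractf mult.commute)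
  have cut_n: "2 * k + 3 + sum n (?cut S) \<le> (k + 1) * card (?cut S)"
    if "S \<subseteq> V" "odd (card S)" for S
    using bal that by (simp add: cut_balanced_def k_def n_def)
  have frac: "fractional_matching V E (\<lambda>e. e) w"
    unfolding fractional_matching_def
  proof (intro conjI ballI allI impI)
    fix e
    have "n e \<le> k" by (simp add: n_def k_def multiplicity_def)
    then show "0 \<le> w e" by (simp add: w_def)
  next
    fix v assume "v \<in> V"
    then show "sum w (?cut {v}) = 1" using D by (simp add: sum_w star3 star_n field_simps)
  next
    fix S assume S: "S \<subseteq> V" "odd (card S)"
    have "real (2 * k + 3 + sum n (?cut S)) \<le> real ((k + 1) * card (?cut S))"
      using cut_n[OF S] by (rule of_nat_mono)
    then show "1 \<le> sum w (?cut S)" using D by (simp add: sum_w field_simps)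
  qed
  obtain M where M: "matching V E (\<lambda>e. e) M"
    and gain: "(\<Sum>e\<in>E. (if e \<in> U then 1 else 0) * w e) \<le> (\<Sum>e\<in>M. if e \<in> U then 1 else 0)"
    and tight: "\<forall>S\<subseteq>V. odd (card S) \<longrightarrow> sum w (?cut S) = 1 \<longrightarrow> card (cut M (\<lambda>e. e) S) = 1"
    using matching_meeting_tight_cuts_once[OF g frac, of "\<lambda>e. if e \<in> U then 1 else 0"] by blast
  have ME: "M \<subseteq> E" using M by (simp add: matching_def)
  have finM: "finite M" using ME fin by (rule finite_subset)
  show thesis
  proof (rule that[of M])
    show "cut_balanced V E (M # Ms)"
      unfolding cut_balanced_def
    proof (intro conjI allI impI)
      show "\<forall>N\<in>set (M # Ms). matching V E (\<lambda>e. e) N"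
        using M bal by (simp add: cut_balanced_def)
      fix S assume S: "S \<subseteq> V" "odd (card S)"
      have cutM: "M \<inter> ?cut S = cut M (\<lambda>e. e) S" using cut_inter[OF ME] by (rule sym)
      have m_le: "card (M \<inter> ?cut S) \<le> card (?cut S)" using fin by (intro card_mono) auto
      have "2 * k + 5 + sum n (?cut S) + card (M \<inter> ?cut S) \<le> (k + 2) * card (?cut S)"
      proof (cases "2 * k + 3 + sum n (?cut S) = (k + 1) * card (?cut S)")
        case True
        then have "real (2 * k + 3 + sum n (?cut S)) = real ((k + 1) * card (?cut S))" by simp
        then have "sum w (?cut S) = 1" using D by (simp add: sum_w field_simps)
        then have "card (M \<inter> ?cut S) = 1" using tight S cutM by simp
        then show ?thesis using True odd_cut_at_least_three[OF G S] by simp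
      next
        case False
        have "card S * k = 2 * sum n {e \<in> E. e \<subseteq> S} + sum n (?cut S)"
          using sum_stars[OF g order_refl S(1), of n] star_n S(1) by (simp add: subset_iff)
        then have "even (card S * k) \<longleftrightarrow> even (2 * sum n {e \<in> E. e \<subseteq> S} + sum n (?cut S))"
          by (simp only:)
        then have "even (sum n (?cut S)) \<longleftrightarrow> even k" using S(2) by simp
        moreover have "odd (card (?cut S))" by (rule odd_cut_cubic[OF G(1,2) S])
        ultimately have "even ((k + 1) * card (?cut S)) \<longleftrightarrow> odd (sum n (?cut S))" by simp
        then have "even ((k + 1) * card (?cut S)) \<longleftrightarrow> even (2 * k + 3 + sum n (?cut S))" by simp
        then have "(k + 1) * card (?cut S) \<noteq> 2 * k + 3 + sum n (?cut S) + 1" by (metis even_plus_one_iff)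
        then have "2 * k + 5 + sum n (?cut S) \<le> (k + 1) * card (?cut S)"
          using cut_n[OF S] False by linarith
        then show ?thesis using m_le by simp
      qed
      then show "2 * length (M # Ms) + 3 + sum (multiplicity (M # Ms)) (?cut S)
          \<le> (length (M # Ms) + 1) * card (?cut S)"
        using fin by (simp add: sum_multiplicity_Cons k_def n_def)
    qed
    have "(\<Sum>e\<in>E. (if e \<in> U then 1 else 0) * w e) = sum w U"
    proof -
      have "E \<inter> U = U" by (auto simp: U_def)
      then show ?thesis using fin by (simp add: if_distrib[of "\<lambda>x. x * _"] sum.If_cases cong: if_cong)
    qed
    moreover have "sum n U = 0"
      by (auto simp: n_def multiplicity_def U_def filter_empty_conv)
    ultimately have "(real k + 1) * real (card U) / (2 * real k + 3) \<le> real (card (M \<inter> U))"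
      using gain finM by (simp add: sum_w sum.If_cases)
    then have "(real k + 1) * real (card U) \<le> (2 * real k + 3) * real (card (M \<inter> U))"
      using D by (simp add: field_simps)
    then have "real ((k + 1) * card U) \<le> real ((2 * k + 3) * card (M \<inter> U))"
      by (simp add: algebra_simps)
    then have ineq: "(k + 1) * card U \<le> (2 * k + 3) * card (M \<inter> U)" by linarith
    have "E - \<Union>(set (M # Ms)) = U - (M \<inter> U)" by (auto simp: U_def)
    then have "card U = card (E - \<Union>(set (M # Ms))) + card (M \<inter> U)"
      using finU by (simp add: card_Diff_subset card_mono)
    then show "(2 * length Ms + 3) * card (E - \<Union>(set (M # Ms))) \<le> (length Ms + 2) * card (E - \<Union>(set Ms))"
      using ineq unfolding U_def[symmetric] k_def[symmetric] by (simp add: algebra_simps)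
  qed
qed

definition uncovered_fraction :: "nat \<Rightarrow> real" where
  "uncovered_fraction t = (\<Prod>i=1..t. (real i + 1) / (2 * real i + 1))"

lemma uncovered_fraction_Suc:
  "uncovered_fraction (Suc t) = uncovered_fraction t * ((real t + 2) / (2 * real t + 3))"
  by (simp add: uncovered_fraction_def add.commute)

lemma matchings_with_few_uncovered_edges:
  assumes G: "finite_simple_graph V E" "cubic V E" "bridgeless V E"
  shows "\<exists>Ms. length Ms = t \<and> cut_balanced V E Ms \<and>
    real (card (E - \<Union>(set Ms))) \<le> uncovered_fraction t * real (card E)"
proof (induction t)
  case 0
  have "cut_balanced V E []"
    using odd_cut_at_least_three[OF G] by (simp add: cut_balanced_def multiplicity_def)
  then show ?case by (intro exI[of _ "[]"]) (simp add: uncovered_fraction_def)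
next
  case (Suc t)
  then obtain Ms where Ms: "length Ms = t" "cut_balanced V E Ms"
    "real (card (E - \<Union>(set Ms))) \<le> uncovered_fraction t * real (card E)" by blast
  obtain M where M: "cut_balanced V E (M # Ms)"
    "(2 * t + 3) * card (E - \<Union>(set (M # Ms))) \<le> (t + 2) * card (E - \<Union>(set Ms))"
    using extend_cut_balanced[OF G Ms(2)] Ms(1) by blast
  have "real ((2 * t + 3) * card (E - \<Union>(set (M # Ms)))) \<le> real ((t + 2) * card (E - \<Union>(set Ms)))"
    using M(2) by (rule of_nat_mono)
  then have "real (card (E - \<Union>(set (M # Ms)))) \<le> (real t + 2) / (2 * real t + 3) * real (card (E - \<Union>(set Ms)))"
    by (simp add: field_simps)
  also have "\<dots> \<le> (real t + 2) / (2 * real t + 3) * (uncovered_fraction t * real (card E))"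
    using Ms(3) by (intro mult_left_mono) auto
  finally show ?case
    using Ms(1) M(1) by (intro exI[of _ "M # Ms"]) (simp add: uncovered_fraction_Suc mult_ac)
qed

section \<open>Numerical estimate and conclusion\<close>

text \<open>
  The quotient of the two sides decreases in \<open>t\<close>, and \<open>t = 5\<close> is the first value for which it is at
  most \<open>1\<close>.
\<close>

lemma uncovered_fraction_bound:
  assumes "5 \<le> t"
  shows "uncovered_fraction t * 2 ^ t \<le> sqrt (real t)"
  using assms
proof (induction t rule: nat_induct_at_least)
  case base
  have "uncovered_fraction 5 * 2 ^ 5 = 512 / 231"
    by (simp add: uncovered_fraction_def numeral_eq_Suc atLeastAtMostSuc_conv)
  also have "\<dots> \<le> sqrt 5" by (rule real_le_rsqrt) (simp add: power2_eq_square)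
  finally show ?case by simp
next
  case (Suc t)
  have "uncovered_fraction (Suc t) * 2 ^ Suc t =
      (uncovered_fraction t * 2 ^ t) * ((2 * real t + 4) / (2 * real t + 3))"
    by (simp add: uncovered_fraction_Suc field_simps)
  also have "\<dots> \<le> sqrt (real t) * ((2 * real t + 4) / (2 * real t + 3))"
    using Suc by (intro mult_right_mono) auto
  also have "\<dots> \<le> sqrt (real (Suc t))"
  proof (rule real_le_rsqrt)
    have "real t * (2 * real t + 4)\<^sup>2 \<le> (real t + 1) * (2 * real t + 3)\<^sup>2"
      by (simp add: power2_eq_square algebra_simps)
    then have "real t * (2 * real t + 4)\<^sup>2 / (2 * real t + 3)\<^sup>2 \<le> real t + 1"
      by (subst pos_divide_le_eq) auto
    then show "(sqrt (real t) * ((2 * real t + 4) / (2 * real t + 3)))\<^sup>2 \<le> real (Suc t)"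
      by (simp add: power_mult_distrib power_divide add.commute)
  qed
  finally show ?case .
qed

text \<open>
  For \<open>t \<le> 3\<close> there is no number \<open>m\<close> as required. For \<open>t = 4\<close> the product is slightly larger
  than \<open>sqrt t / 2 ^ t\<close>, but \<open>m\<close> is an integer and so at most \<open>7\<close>.
\<close>

lemma less_than_one_edge_uncovered:
  assumes t: "t > 0" and m: "6 \<le> m" "real m < 2 ^ t / sqrt (real t)"
  shows "uncovered_fraction t * real m < 1"
proof -
  have m': "real m * sqrt (real t) < 2 ^ t" using t m(2) by (simp add: field_simps)
  consider "t \<le> 3" | "t = 4" | "5 \<le> t" by linarith
  then show ?thesis
  proof cases
    case 1
    have "4 / 3 < sqrt 3" by (rule real_less_rsqrt) (simp add: power2_eq_square)
    moreover have "4 / 3 < sqrt 2" by (rule real_less_rsqrt) (simp add: power2_eq_square)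
    moreover have "6 * sqrt (real t) \<le> real m * sqrt (real t)"
      using m(1) by (intro mult_right_mono) auto
    then have "6 * sqrt (real t) < 2 ^ t" using m' by linarith
    moreover have "t = 1 \<or> t = 2 \<or> t = 3" using 1 t by linarith
    ultimately have False by auto
    then show ?thesis ..
  next
    case 2
    have "sqrt 4 = (2 :: real)" using real_sqrt_abs[of 2] by simp
    then have "m \<le> 7" using m' 2 by simp
    have u: "uncovered_fraction 4 = 8 / 63"
      by (simp add: uncovered_fraction_def numeral_eq_Suc atLeastAtMostSuc_conv)
    show ?thesis unfolding 2 u using \<open>m \<le> 7\<close> by simp
  next
    case 3
    have "uncovered_fraction t * real m * 2 ^ t \<le> real m * sqrt (real t)"
      using mult_left_mono[OF uncovered_fraction_bound[OF 3], of "real m"] by (simp add: mult_ac)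
    then have "uncovered_fraction t * real m * 2 ^ t < 1 * 2 ^ t" using m' by linarith
    then show ?thesis by (simp only: mult_less_cancel_right_pos zero_less_power zero_less_numeral)
  qed
qed

theorem theorem4p1:
  fixes t :: nat and V :: "'a set" and E :: "'a set set"
  assumes "t > 0"
    and "finite_simple_graph V E" and "graph_connected V E"
    and "bridgeless V E" and "cubic V E"
    and "real (card E) < 2 ^ t / sqrt (real t)"
  shows "\<exists>M :: nat \<Rightarrow> 'a set set.
    (\<forall>i\<in>{1..t}. perfect_matching V E (M i)) \<and> (\<Union>i\<in>{1..t}. M i) = E"
proof -
  note G = assms(2) assms(5) assms(4)
  have "V \<noteq> {}" using assms(3) by (simp add: graph_connected_def)
  then have "6 \<le> card E" by (rule cubic_at_least_six_edges[OF G(1,2)])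
  then have small: "uncovered_fraction t * real (card E) < 1"
    by (rule less_than_one_edge_uncovered[OF assms(1) _ assms(6)])
  obtain Ms where Ms: "length Ms = t" "cut_balanced V E Ms"
    "real (card (E - \<Union>(set Ms))) \<le> uncovered_fraction t * real (card E)"
    using matchings_with_few_uncovered_edges[OF G] by blast
  have "card (E - \<Union>(set Ms)) = 0" using Ms(3) small by simp
  moreover have "finite E" using multigraph_of_simple_graph[OF G(1)] by (simp add: multigraph_def)
  ultimately have cover: "E \<subseteq> \<Union>(set Ms)" by simp
  have pm: "perfect_matching V E M" if "M \<in> set Ms" for M
    using Ms(2) that by (simp add: perfect_matching_iff[OF G(1)] cut_balanced_def)
  have index: "(\<lambda>i. Ms ! (i - 1)) ` {1..t} = set Ms"
  proof -
    have "set Ms = (\<lambda>i. Ms ! i) ` {0..<t}" using Ms(1) by (auto simp: set_conv_nth)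
    also have "\<dots> = (\<lambda>i. Ms ! (i - 1)) ` Suc ` {0..<t}" by (simp only: image_image diff_Suc_1)
    also have "Suc ` {0..<t} = {1..t}" by (auto simp: image_Suc_atLeastLessThan)
    finally show ?thesis by (rule sym)
  qed
  show ?thesis
  proof (intro exI[of _ "\<lambda>i. Ms ! (i - 1)"] conjI ballI)
    show "perfect_matching V E (Ms ! (i - 1))" if "i \<in> {1..t}" for i
      using pm index that by blast
    show "(\<Union>i\<in>{1..t}. Ms ! (i - 1)) = E"
      unfolding index using cover pm by (auto simp: perfect_matching_def)
  qed
qed

end
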